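(* Let $G:\mathcal I^n\to\mathbb R$ be a function satisfying: (i) $G(\mathbf 1_{(N,N)})=1$; (ii) (monotonicity) for all $\mathbf x,\mathbf y\in\mathcal I^n$ with $\mathbf x\le\mathbf y$, $G(\mathbf x)\le G(\mathbf y)$; (iii) (comonotone additivity) for all comonotone $\mathbf x,\mathbf y\in\mathcal I^n$, $G(\mathbf x+\mathbf y)=G(\mathbf x)+G(\mathbf y)$. Define $\mu_r(A,B)=G(\mathbf 1_{(A,B)})$ for all $(A,B)\in\mathcal Q$. Then $\mu_r$ is an interval capacity on $\mathcal Q$ and $$G(\mathbf x)=Ch_r(\mathbf x,\mu_r)\qquad\text{for all }\mathbf x\in\mathcal I^n.$$
   Context: Let $n\ge 1$ and $N=\{1,\dots,n\}$. Let $\mathcal I=\{[a,b] : a,b\in\mathbb R,\ a\le b\}$; elements of $\mathcal I^n$ are written $\mathbf x=([\underline x_1,\overline x_1],\dots,[\underline x_n,\overline x_n])$. A real $x$ is identified with $[x,x]$. Sum: $[x_1,x_2]+[y_1,y_2]=[x_1+y_1,x_2+y_2]$, extended componentwise to $\mathcal I^n$. Order: $[\alpha,\beta]\le[\alpha_1,\beta_1]$ iff $\alpha\le\alpha_1$ and $\beta\le\beta_1$, extended componentwise to $\mathcal I^n$ (so $\mathbf x\le\mathbf y$ iff this holds in every component). Comonotonicity: two vectors $u,v\in\mathbb R^{m}$ are comonotone if $(u_i-u_j)(v_i-v_j)\ge 0$ for all $i,j$. Two elements $\mathbf x,\mathbf y\in\mathcal I^n$ are comonotone if the vectors $(\underline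 x_1,\dots,\underline x_n,\overline x_1,\dots,\overline x_n)$ and $(\underline y_1,\dots,\underline y_n,\overline y_1,\dots,\overline y_n)$ of $\mathbb R^{2n}$ are comonotone. Let $\mathcal Q=\{(A,B): A\subseteq B\subseteq N\}$, with $(A,B)\subseteq(C,D)$ meaning $A\subseteq C$ and $B\subseteq D$. For $(A,B)\in\mathcal Q$, $\mathbf 1_{(A,B)}\in\mathcal I^n$ is the vector whose $i$-th component is $[1,1]$ if $i\in A$, $[0,1]$ if $i\in B\setminus A$, and $[0,0]$ if $i\in N\setminus B$. An interval capacity is a function $\mu_r:\mathcal Q\to[0,1]$ with $\mu_r(\emptyset,\emptyset)=0$, $\mu_r(N,N)=1$ and $\mu_r(A,B)\le\mu_r(C,D)$ whenever $(A,B)\subseteq(C,D)$. The robust Choquet integral of $\mathbf x\in\mathcal I^n$ with respect to an interval capacity $\mu_r$ is $$Ch_r(\mathbf x,\mu_r)=\int_{\min_i\underline x_i}^{\max_i\overline x_i}\mu_r\big(\{i\in N:\underline x_i\ge t\},\{i\in N:\overline x_i\ge t\}\big)\,dt+\min_i\underline x_i .$$ *)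

theory Defs
  imports "HOL-Analysis.Analysis" "HOL-Library.Interval"
begin

text \<open>
  The set \<open>N\<close> is the universe of the finite index type \<open>'n\<close> (of arbitrary cardinality
  \<open>n \<ge> 1\<close>), and \<open>I\<^sup>n\<close> is the whole type \<open>real interval ^ 'n\<close>. Addition of intervals
  and of interval vectors is the library's endpointwise addition. The library's \<open>\<le>\<close> on
  intervals is inclusion, not the endpointwise order, so the latter is defined here.
\<close>

definition interval_le :: "real interval \<Rightarrow> real interval \<Rightarrow> bool" (infix \<open>\<preceq>\<^sub>I\<close> 50)
  where "a \<preceq>\<^sub>I b \<longleftrightarrow> lower a \<le> lower b \<and> upper a \<le> upper b"

definition ivec_le :: "real interval ^ 'n \<Rightarrow> real interval ^ 'n \<Rightarrow> bool" (infix \<open>\<preceq>\<close> 50)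
  where "x \<preceq> y \<longleftrightarrow> (\<forall>i. x $ i \<preceq>\<^sub>I y $ i)"

definition comonotone_vec :: "real ^ 'm \<Rightarrow> real ^ 'm \<Rightarrow> bool"
  where "comonotone_vec u v \<longleftrightarrow> (\<forall>i j. (u $ i - u $ j) * (v $ i - v $ j) \<ge> 0)"

text \<open>The index type \<open>'n + 'n\<close> has \<open>2n\<close> elements: \<open>Inl i\<close> indexes the lower endpoint and
  \<open>Inr i\<close> the upper endpoint of component \<open>i\<close>.\<close>

definition endpoints :: "real interval ^ 'n \<Rightarrow> real ^ ('n + 'n)"
  where "endpoints x = (\<chi> k. case k of Inl i \<Rightarrow> lower (x $ i) | Inr i \<Rightarrow> upper (x $ i))"

definition comonotone :: "real interval ^ 'n \<Rightarrow> real interval ^ 'n \<Rightarrow> bool"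
  where "comonotone x y \<longleftrightarrow> comonotone_vec (endpoints x) (endpoints y)"

definition QQ :: "('n set \<times> 'n set) set"
  where "QQ = {(A, B). A \<subseteq> B}"

definition ind :: "'n set \<times> 'n set \<Rightarrow> real interval ^ 'n"
  where "ind P = (\<chi> i. if i \<in> fst P then interval_of 1
                       else if i \<in> snd P then Interval (0, 1)
                       else interval_of 0)"

lemma lower_Interval: "a \<le> b \<Longrightarrow> lower (Interval (a, b)) = a"
  by (simp add: lower.rep_eq Interval_inverse)

lemma upper_Interval: "a \<le> b \<Longrightarrow> upper (Interval (a, b)) = b"
  by (simp add: upper.rep_eq Interval_inverse)

lemma lower_ind: "lower (ind (A, B) $ i) = (if i \<in> A then 1 else 0)"
  by (simp add: ind_def lower_Interval)

lemma upper_ind: "A \<subseteq> B \<Longrightarrow> upper (ind (A, B) $ i) = (if i \<in> B then 1 else 0)"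
  by (auto simp: ind_def upper_Interval)

text \<open>Set functions on \<open>QQ\<close> are total in HOL; only their values on \<open>QQ\<close> are constrained or used.\<close>

definition interval_capacity :: "('n set \<times> 'n set \<Rightarrow> real) \<Rightarrow> bool"
  where "interval_capacity \<mu> \<longleftrightarrow>
    (\<forall>P\<in>QQ. \<mu> P \<in> {0..1}) \<and>
    \<mu> ({}, {}) = 0 \<and>
    \<mu> (UNIV, UNIV) = 1 \<and>
    (\<forall>A B C D. (A, B) \<in> QQ \<and> (C, D) \<in> QQ \<and> A \<subseteq> C \<and> B \<subseteq> D \<longrightarrow> \<mu> (A, B) \<le> \<mu> (C, D))"

definition Ch\<^sub>r :: "real interval ^ 'n \<Rightarrow> ('n set \<times> 'n set \<Rightarrow> real) \<Rightarrow> real"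
  where "Ch\<^sub>r x \<mu> =
    integral {Min (range (\<lambda>i. lower (x $ i))) .. Max (range (\<lambda>i. upper (x $ i)))}
      (\<lambda>t. \<mu> ({i. lower (x $ i) \<ge> t}, {i. upper (x $ i) \<ge> t}))
    + Min (range (\<lambda>i. lower (x $ i)))"

end

theory Submission
  imports Defs
begin

text \<open>
  Fix \<open>x\<close> and transform all its endpoints by one nondecreasing \<open>\<phi>\<close>. Any two interval vectors
  obtained in this way are comonotone, so \<open>H \<phi> = G (\<phi> \<circ> x)\<close> is a monotone and additive
  functional on the whole cone of nondecreasing functions \<open>\<phi> : \<real> \<rightarrow> \<real>\<close>. Both sides of the
  theorem are values of \<open>H\<close>: the identity gives \<open>G x\<close>, and the step function
  \<open>\<one>\<^bsub>[t, \<infinity>)\<^esub>\<close> gives \<open>\<mu>\<^sub>r\<close> at the level sets of \<open>x\<close> at height \<open>t\<close>.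

  Additivity and monotonicity make \<open>H\<close> positively homogeneous (Cauchy's functional equation).
  For the truncations \<open>g t = H (\<lambda>u. min u t)\<close> and the step values \<open>h t = H \<one>\<^bsub>[t, \<infinity>)\<^esub>\<close> this
  turns the pointwise bounds, valid for \<open>s \<le> t\<close>,
  \<open>(t - s) \<one>\<^bsub>[t, \<infinity>)\<^esub> u \<le> min u t - min u s \<le> (t - s) \<one>\<^bsub>[s, \<infinity>)\<^esub> u\<close>
  into \<open>(t - s) h t \<le> g t - g s \<le> (t - s) h s\<close>. Hence \<open>g\<close> is Lipschitz with \<open>g' = h\<close> wherever
  \<open>h\<close> is continuous, which is everywhere except at the finitely many endpoints of \<open>x\<close>, and the
  fundamental theorem of calculus gives \<open>g b - g a = \<integral>\<^sub>a\<^sup>b h\<close>. With \<open>a\<close> the least and \<open>b\<close> the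
  greatest endpoint, truncation at \<open>b\<close> leaves \<open>x\<close> unchanged and truncation at \<open>a\<close> makes it the
  constant \<open>a\<close>, so that \<open>g b = G x\<close> and \<open>g a = a\<close>.
\<close>

section \<open>Antiderivatives squeezed between rectangles\<close>

text \<open>
  The hypothesis says that the increment of \<open>g\<close> lies between the lower and the upper rectangle
  of the necessarily nonincreasing \<open>h\<close>. The difference quotient of \<open>g\<close> at \<open>t\<close> is then
  between \<open>h s\<close> and \<open>h t\<close>, so continuity of \<open>h\<close> at \<open>t\<close> is what differentiability needs.
\<close>

lemma has_integral_of_squeezed_increments:
  fixes g h :: "real \<Rightarrow> real"
  assumes lower: "\<And>s t. s \<le> t \<Longrightarrow> (t - s) * h t \<le> g t - g s"
    and upper: "\<And>s t. s \<le> t \<Longrightarrow> g t - g s \<le> (t - s) * h s"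
    and bound: "\<And>t. \<bar>h t\<bar> \<le> K"
    and "finite S"
    and cont: "\<And>t. t \<notin> S \<Longrightarrow> isCont h t"
    and "a \<le> b"
  shows "(h has_integral g b - g a) {a..b}"
proof (rule fundamental_theorem_of_calculus_interior_strong)
  have lip: "\<bar>g t - g s\<bar> \<le> K * (t - s)" if "s \<le> t" for s t
  proof -
    have "h s \<le> K" "- K \<le> h t"
      using bound[of s] bound[of t] by linarith+
    then have "(t - s) * h s \<le> (t - s) * K" "(t - s) * (- K) \<le> (t - s) * h t"
      using that by (intro mult_left_mono; simp)+
    then show ?thesis
      using lower[OF that] upper[OF that] by (simp add: abs_le_iff algebra_simps)
  qed
  have "K-lipschitz_on {a..b} g"
  proof (rule lipschitz_onI)
    show "0 \<le> K"
      using bound[of 0] by linarith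
    show "dist (g s) (g t) \<le> K * dist s t" for s t
      using lip[of s t] lip[of t s]
      by (cases "s \<le> t") (simp_all add: dist_real_def abs_minus_commute)
  qed
  then show "continuous_on {a..b} g"
    by (rule lipschitz_on_continuous_on)
next
  fix t assume "t \<in> {a<..<b} - S"
  then have h: "(h \<longlongrightarrow> h t) (at t)"
    using cont by (simp add: isCont_def)
  have near: "\<bar>(g s - g t) / (s - t) - h t\<bar> \<le> \<bar>h s - h t\<bar>" if "s \<noteq> t" for s
  proof (cases "t < s")
    case True
    then have "h s \<le> (g s - g t) / (s - t)" "(g s - g t) / (s - t) \<le> h t"
      using lower[of t s] upper[of t s] by (simp_all add: field_simps)
    then show ?thesis by linarith
  next
    case False
    then have "s < t" using that by simp
    then have "h t \<le> (g t - g s) / (t - s)" "(g t - g s) / (t - s) \<le> h s"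
      using lower[of s t] upper[of s t] by (simp_all add: field_simps)
    moreover have "(g t - g s) / (t - s) = (g s - g t) / (s - t)"
      by (metis minus_diff_eq minus_divide_divide)
    ultimately show ?thesis by linarith
  qed
  have "((\<lambda>s. (g s - g t) / (s - t) - h t) \<longlongrightarrow> 0) (at t)"
  proof (rule tendsto_0_le)
    show "((\<lambda>s. h s - h t) \<longlongrightarrow> 0) (at t)"
      using h by (simp add: LIM_zero)
    show "\<forall>\<^sub>F s in at t. norm ((g s - g t) / (s - t) - h t) \<le> norm (h s - h t) * 1"
      using near by (simp add: eventually_at_filter)
  qed
  then have "((\<lambda>s. (g s - g t) / (s - t)) \<longlongrightarrow> h t) (at t)"
    by (rule LIM_zero_cancel)
  then show "(g has_vector_derivative h t) (at t)"
    by (simp add: has_field_derivative_iff flip: has_real_derivative_iff_has_vector_derivative)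
qed (use assms in auto)

section \<open>Monotone additive functionals of nondecreasing functions\<close>

lemma additive_monotone_imp_linear:
  fixes f :: "real \<Rightarrow> real"
  assumes add: "\<And>c d. 0 \<le> c \<Longrightarrow> 0 \<le> d \<Longrightarrow> f (c + d) = f c + f d"
    and mono: "\<And>c d. 0 \<le> c \<Longrightarrow> c \<le> d \<Longrightarrow> f c \<le> f d"
    and "0 \<le> c"
  shows "f c = c * f 1"
proof -
  have f0: "f 0 = 0"
    using add[of 0 0] by simp
  have mult: "f (real n * d) = real n * f d" if "0 \<le> d" for n d
    by (induction n) (use that f0 add in \<open>auto simp: algebra_simps\<close>)
  have f_nat: "f (real n) = real n * f 1" for n
    using mult[of 1 n] by simp
  have f1: "0 \<le> f 1"
    using mono[of 0 1] f0 by simp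
  \<comment> \<open>Rounding \<open>n c\<close> to an integer costs at most \<open>f 1\<close>, whatever \<open>n\<close> is.\<close>
  have "real n * \<bar>f c - c * f 1\<bar> \<le> f 1" for n
  proof -
    define m where "m = nat \<lfloor>real n * c\<rfloor>"
    have m: "real m \<le> real n * c" "real n * c \<le> real (m + 1)"
      using \<open>0 \<le> c\<close> unfolding m_def by (auto simp: of_nat_nat) linarith
    have "real m * f 1 \<le> real n * f c" "real n * f c \<le> real (m + 1) * f 1"
      using mono[OF _ m(1)] mono[OF _ m(2)] \<open>0 \<le> c\<close>
      by (simp_all only: f_nat mult mult_nonneg_nonneg of_nat_0_le_iff)
    moreover have "real m * f 1 \<le> real n * c * f 1" "real n * c * f 1 \<le> real (m + 1) * f 1"
      using m f1 by (auto intro!: mult_right_mono)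
    ultimately have "\<bar>real n * f c - real n * c * f 1\<bar> \<le> f 1"
      by (simp add: algebra_simps abs_le_iff)
    then show ?thesis
      by (simp add: abs_mult mult.assoc flip: right_diff_distrib)
  qed
  then show ?thesis
    by (metis abs_le_zero_iff eq_iff_diff_eq_0 linorder_not_le reals_Archimedean3)
qed

definition step :: "real \<Rightarrow> real \<Rightarrow> real"
  where "step t u = (if t \<le> u then 1 else 0)"

lemma mono_step: "mono (step t)"
  by (auto simp: mono_def step_def)

lemma positively_homogeneous:
  fixes H :: "(real \<Rightarrow> real) \<Rightarrow> real"
  assumes add: "\<And>\<phi> \<psi>. mono \<phi> \<Longrightarrow> mono \<psi> \<Longrightarrow> H (\<lambda>u. \<phi> u + \<psi> u) = H \<phi> + H \<psi>"
    and mono: "\<And>\<phi> \<psi>. mono \<phi> \<Longrightarrow> mono \<psi> \<Longrightarrow> (\<And>u. \<phi> u \<le> \<psi> u) \<Longrightarrow> H \<phi> \<le> H \<psi>"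
    and \<phi>: "mono \<phi>" "\<And>u. 0 \<le> \<phi> u" and "0 \<le> c"
  shows "H (\<lambda>u. c * \<phi> u) = c * H \<phi>"
proof -
  have scale: "mono (\<lambda>u. d * \<phi> u)" if "0 \<le> d" for d
    using \<phi>(1) that by (auto simp: mono_def intro: mult_left_mono)
  have "H (\<lambda>u. c * \<phi> u) = c * H (\<lambda>u. 1 * \<phi> u)"
  proof (rule additive_monotone_imp_linear[of "\<lambda>c. H (\<lambda>u. c * \<phi> u)"])
    fix c d :: real assume "0 \<le> c" "0 \<le> d"
    then show "H (\<lambda>u. (c + d) * \<phi> u) = H (\<lambda>u. c * \<phi> u) + H (\<lambda>u. d * \<phi> u)"
      by (simp add: distrib_right add scale)
  next
    fix c d :: real assume "0 \<le> c" "c \<le> d"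
    then show "H (\<lambda>u. c * \<phi> u) \<le> H (\<lambda>u. d * \<phi> u)"
      using \<phi>(2) by (intro mono scale mult_right_mono) auto
  qed fact
  then show ?thesis by simp
qed

text \<open>
  The layer-cake formula \<open>min u b - min u a = \<integral>\<^sub>a\<^sup>b step t u dt\<close> survives the application of
  \<open>H\<close>. This is the step from algebra to integration in the representation theorem.
\<close>

lemma layer_cake:
  fixes H :: "(real \<Rightarrow> real) \<Rightarrow> real"
  assumes add: "\<And>\<phi> \<psi>. mono \<phi> \<Longrightarrow> mono \<psi> \<Longrightarrow> H (\<lambda>u. \<phi> u + \<psi> u) = H \<phi> + H \<psi>"
    and mono: "\<And>\<phi> \<psi>. mono \<phi> \<Longrightarrow> mono \<psi> \<Longrightarrow> (\<And>u. \<phi> u \<le> \<psi> u) \<Longrightarrow> H \<phi> \<le> H \<psi>"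
    and "finite S" and "\<And>t. t \<notin> S \<Longrightarrow> isCont (\<lambda>t. H (step t)) t"
    and "a \<le> b"
  shows "((\<lambda>t. H (step t)) has_integral H (\<lambda>u. min u b) - H (\<lambda>u. min u a)) {a..b}"
proof (rule has_integral_of_squeezed_increments)
  fix s t :: real assume "s \<le> t"
  define \<delta> where "\<delta> u = min u t - min u s" for u
  have m: "mono \<delta>" "mono (\<lambda>u. min u s)" "mono (\<lambda>u. (t - s) * step t u)"
    "mono (\<lambda>u. (t - s) * step s u)"
    using \<open>s \<le> t\<close> by (auto simp: mono_def \<delta>_def step_def min_def)
  have "H (\<lambda>u. \<delta> u + min u s) = H \<delta> + H (\<lambda>u. min u s)"
    by (rule add) (use m in auto)
  then have \<delta>: "H (\<lambda>u. min u t) - H (\<lambda>u. min u s) = H \<delta>"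
    by (simp add: \<delta>_def)
  have hom: "H (\<lambda>u. (t - s) * step r u) = (t - s) * H (step r)" for r
    by (rule positively_homogeneous[of H, OF add mono mono_step])
      (use \<open>s \<le> t\<close> in \<open>auto simp: step_def\<close>)
  have "H (\<lambda>u. (t - s) * step t u) \<le> H \<delta>"
    by (rule mono[OF m(3,1)]) (use \<open>s \<le> t\<close> in \<open>auto simp: \<delta>_def step_def\<close>)
  then show "(t - s) * H (step t) \<le> H (\<lambda>u. min u t) - H (\<lambda>u. min u s)"
    by (simp only: \<delta> hom)
  have "H \<delta> \<le> H (\<lambda>u. (t - s) * step s u)"
    by (rule mono[OF m(1,4)]) (use \<open>s \<le> t\<close> in \<open>auto simp: \<delta>_def step_def\<close>)
  then show "H (\<lambda>u. min u t) - H (\<lambda>u. min u s) \<le> (t - s) * H (step s)"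
    by (simp only: \<delta> hom)
next
  fix t
  have const: "mono (\<lambda>u::real. c)" for c :: real
    by (simp add: mono_def)
  have "H (\<lambda>u. 0) = 0"
    using add[OF const[of 0] const[of 0]] by simp
  then have "0 \<le> H (step t)"
    using mono[OF const[of 0] mono_step[of t]] by (simp add: step_def)
  moreover have "H (step t) \<le> H (\<lambda>u. 1)"
    by (rule mono[OF mono_step const]) (simp add: step_def)
  ultimately show "\<bar>H (step t)\<bar> \<le> H (\<lambda>u. 1)"
    by simp
qed (use assms in auto)

section \<open>Nondecreasing transformations of interval vectors\<close>

text \<open>For nondecreasing \<open>\<phi>\<close> only: otherwise the pair need not be ordered.\<close>

definition ivec_map :: "(real \<Rightarrow> real) \<Rightarrow> real interval ^ 'n \<Rightarrow> real interval ^ 'n"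
  where "ivec_map \<phi> x = (\<chi> i. Interval (\<phi> (lower (x $ i)), \<phi> (upper (x $ i))))"

lemma lower_ivec_map: "mono \<phi> \<Longrightarrow> lower (ivec_map \<phi> x $ i) = \<phi> (lower (x $ i))"
  by (simp add: ivec_map_def lower_Interval monoD)

lemma upper_ivec_map: "mono \<phi> \<Longrightarrow> upper (ivec_map \<phi> x $ i) = \<phi> (upper (x $ i))"
  by (simp add: ivec_map_def upper_Interval monoD)

lemma ivec_eqI:
  assumes "\<And>i. lower (x $ i) = lower (y $ i)" "\<And>i. upper (x $ i) = upper (y $ i)"
  shows "x = y"
  using assms by (simp add: vec_eq_iff interval_eq_iff)

text \<open>
  Both endpoint vectors are nondecreasing images of the endpoints of the same \<open>x\<close>, hence
  ordered alike. This makes comonotone additivity applicable to every pair of transformations.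
\<close>

lemma comonotone_ivec_map:
  fixes x :: "real interval ^ 'n"
  assumes "mono \<phi>" "mono \<psi>"
  shows "comonotone (ivec_map \<phi> x) (ivec_map \<psi> x)"
proof -
  have ends: "endpoints (ivec_map \<theta> x) $ k = \<theta> (endpoints x $ k)" if "mono \<theta>" for \<theta> k
    using that by (simp add: endpoints_def lower_ivec_map upper_ivec_map split: sum.split)
  have "0 \<le> (\<phi> p - \<phi> q) * (\<psi> p - \<psi> q)" for p q
    using monoD[OF assms(1), of p q] monoD[OF assms(1), of q p]
      monoD[OF assms(2), of p q] monoD[OF assms(2), of q p]
    by (cases "p \<le> q") (auto intro: mult_nonneg_nonneg mult_nonpos_nonpos)
  then show ?thesis
    by (simp add: comonotone_def comonotone_vec_def ends assms)
qed

lemma ivec_map_add: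
  assumes "mono \<phi>" "mono \<psi>"
  shows "ivec_map (\<lambda>u. \<phi> u + \<psi> u) x = ivec_map \<phi> x + ivec_map \<psi> x"
proof -
  have "mono (\<lambda>u. \<phi> u + \<psi> u)"
    using assms by (simp add: mono_def add_mono)
  then show ?thesis
    by (intro ivec_eqI) (simp_all add: lower_ivec_map upper_ivec_map assms)
qed

lemma ivec_map_mono:
  assumes "mono \<phi>" "mono \<psi>" "\<And>u. \<phi> u \<le> \<psi> u"
  shows "ivec_map \<phi> x \<preceq> ivec_map \<psi> x"
  using assms by (simp add: ivec_le_def interval_le_def lower_ivec_map upper_ivec_map)

lemma ivec_map_id: "ivec_map (\<lambda>u. u) x = x"
  by (intro ivec_eqI) (simp_all add: lower_ivec_map upper_ivec_map mono_def)

lemma level_sets_mem_QQ: "({i. t \<le> lower (x $ i)}, {i. t \<le> upper (x $ i)}) \<in> QQ"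
  unfolding QQ_def using lower_le_upper order_trans by blast

lemma ivec_map_step: "ivec_map (step t) x = ind ({i. t \<le> lower (x $ i)}, {i. t \<le> upper (x $ i)})"
  using level_sets_mem_QQ[of t x]
  by (intro ivec_eqI)
    (simp_all add: lower_ivec_map upper_ivec_map mono_step lower_ind upper_ind QQ_def step_def)

text \<open>A level set changes only when the level passes an endpoint.\<close>

lemma isCont_level_sets:
  fixes x :: "real interval ^ 'n" and F :: "'n set \<times> 'n set \<Rightarrow> real"
  assumes "t \<notin> range (\<lambda>i. lower (x $ i)) \<union> range (\<lambda>i. upper (x $ i))"
  shows "isCont (\<lambda>t. F ({i. t \<le> lower (x $ i)}, {i. t \<le> upper (x $ i)})) t"
proof -
  have side: "\<forall>\<^sub>F s in nhds t. (s \<le> u) = (t \<le> u)" if "t \<noteq> u" for u :: real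
  proof (cases "t < u")
    case True
    then have "\<forall>\<^sub>F s in nhds t. s < u"
      by (intro order_tendstoD(2)[OF filterlim_ident])
    then show ?thesis
      by eventually_elim (use True in auto)
  next
    case False
    then have "\<forall>\<^sub>F s in nhds t. u < s"
      using that by (intro order_tendstoD(1)[OF filterlim_ident]) auto
    then show ?thesis
      by eventually_elim (use False that in auto)
  qed
  have "\<forall>\<^sub>F s in nhds t. \<forall>i. (s \<le> lower (x $ i)) = (t \<le> lower (x $ i))"
    "\<forall>\<^sub>F s in nhds t. \<forall>i. (s \<le> upper (x $ i)) = (t \<le> upper (x $ i))"
    using assms by (auto intro!: eventually_all_finite side)
  then have "\<forall>\<^sub>F s in nhds t. F ({i. s \<le> lower (x $ i)}, {i. s \<le> upper (x $ i)})
      = F ({i. t \<le> lower (x $ i)}, {i. t \<le> upper (x $ i)})"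
    by eventually_elim simp
  then show ?thesis
    by (subst isCont_cong) auto
qed

section \<open>The representation theorem\<close>

theorem theorem2:
  fixes G :: "real interval ^ 'n \<Rightarrow> real"
    and \<mu>\<^sub>r :: "'n set \<times> 'n set \<Rightarrow> real"
  assumes normalized: "G (ind (UNIV, UNIV)) = 1"
    and monotone: "\<And>x y. x \<preceq> y \<Longrightarrow> G x \<le> G y"
    and comonotone_additive: "\<And>x y. comonotone x y \<Longrightarrow> G (x + y) = G x + G y"
    and capacity_def: "\<And>A B. (A, B) \<in> QQ \<Longrightarrow> \<mu>\<^sub>r (A, B) = G (ind (A, B))"
  shows "interval_capacity \<mu>\<^sub>r \<and> (\<forall>x. G x = Ch\<^sub>r x \<mu>\<^sub>r)"
proof -
  define H where "H x \<phi> = G (ivec_map \<phi> x)" for x \<phi>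
  have H_add: "H x (\<lambda>u. \<phi> u + \<psi> u) = H x \<phi> + H x \<psi>" if "mono \<phi>" "mono \<psi>" for x \<phi> \<psi>
    unfolding H_def
    by (simp add: ivec_map_add comonotone_additive comonotone_ivec_map that)
  have H_mono: "H x \<phi> \<le> H x \<psi>" if "mono \<phi>" "mono \<psi>" "\<And>u. \<phi> u \<le> \<psi> u" for x \<phi> \<psi>
    unfolding H_def by (intro monotone ivec_map_mono that)
  have const: "mono (\<lambda>u::real. c)" for c :: real
    by (simp add: mono_def)
  have map_const: "ivec_map (\<lambda>u. 0) x = ind ({}, {})" "ivec_map (\<lambda>u. 1) x = ind (UNIV, UNIV)"
    for x :: "real interval ^ 'n"
    by (auto intro!: ivec_eqI
        simp: lower_ivec_map upper_ivec_map const lower_ind upper_ind)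
  have H0: "H x (\<lambda>u. 0) = 0" for x
    using H_add[OF const[of 0] const[of 0]] by simp
  have H1: "H x (\<lambda>u. 1) = 1" for x
    by (simp add: H_def map_const normalized)
  have H_nonneg_const: "H x (\<lambda>u. c) = c" if "0 \<le> c" for x c
  proof -
    have "H x (\<lambda>u. c * 1) = c * H x (\<lambda>u. 1)"
      by (rule positively_homogeneous) (fact H_add H_mono const that | simp)+
    then show ?thesis
      by (simp add: H1)
  qed
  have H_const: "H x (\<lambda>u. c) = c" for x c
  proof (cases "0 \<le> c")
    case False
    then have "H x (\<lambda>u. - c) = - c"
      by (simp add: H_nonneg_const)
    moreover have "H x (\<lambda>u. c) + H x (\<lambda>u. - c) = 0"
      using H_add[OF const[of c] const[of "- c"]] H0 by simp
    ultimately show ?thesis by simp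
  qed (rule H_nonneg_const)

  have ind_mono: "G (ind (A, B)) \<le> G (ind (C, D))"
    if "A \<subseteq> B" "C \<subseteq> D" "A \<subseteq> C" "B \<subseteq> D" for A B C D
    using that by (intro monotone) (auto simp: ivec_le_def interval_le_def lower_ind upper_ind)
  have G_empty: "G (ind ({}, {})) = 0"
    using H0 by (simp add: H_def map_const)
  have "interval_capacity \<mu>\<^sub>r"
    unfolding interval_capacity_def
  proof (intro conjI ballI allI impI)
    fix P :: "'n set \<times> 'n set" assume "P \<in> QQ"
    then show "\<mu>\<^sub>r P \<in> {0..1}"
      using ind_mono[of "{}" "{}" "fst P" "snd P"] ind_mono[of "fst P" "snd P" UNIV UNIV]
      by (cases P) (simp add: capacity_def G_empty normalized QQ_def)
  qed (auto simp: capacity_def QQ_def G_empty normalized intro: ind_mono)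

  moreover have "G x = Ch\<^sub>r x \<mu>\<^sub>r" for x
  proof -
    define a where "a = Min (range (\<lambda>i. lower (x $ i)))"
    define b where "b = Max (range (\<lambda>i. upper (x $ i)))"
    have a: "a \<le> lower (x $ i)" for i
      by (simp add: a_def)
    have b: "upper (x $ i) \<le> b" for i
      by (simp add: b_def)
    have bounds: "a \<le> upper (x $ i)" "lower (x $ i) \<le> b" for i
      using a[of i] b[of i] lower_le_upper[of "x $ i"] by linarith+
    have step_eq: "H x (step t) = \<mu>\<^sub>r ({i. t \<le> lower (x $ i)}, {i. t \<le> upper (x $ i)})" for t
      by (simp add: H_def ivec_map_step capacity_def level_sets_mem_QQ)
    have mono_min: "mono (\<lambda>u. min u c)" for c :: real
      by (auto simp: mono_def)
    have "H x (\<lambda>u. min u b) = G (ivec_map (\<lambda>u. u) x)"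
      unfolding H_def
      by (intro arg_cong[of _ _ G] ivec_eqI)
        (simp_all add: lower_ivec_map upper_ivec_map mono_min b bounds mono_def min_absorb1)
    then have top: "H x (\<lambda>u. min u b) = G x"
      by (simp add: ivec_map_id)
    have "H x (\<lambda>u. min u a) = H x (\<lambda>u. a)"
      unfolding H_def
      by (intro arg_cong[of _ _ G] ivec_eqI)
        (simp_all add: lower_ivec_map upper_ivec_map mono_min const a bounds min_absorb2)
    then have bottom: "H x (\<lambda>u. min u a) = a"
      by (simp add: H_const)
    have "((\<lambda>t. H x (step t)) has_integral H x (\<lambda>u. min u b) - H x (\<lambda>u. min u a)) {a..b}"
    proof (rule layer_cake)
      show "finite (range (\<lambda>i. lower (x $ i)) \<union> range (\<lambda>i. upper (x $ i)))"
        by simp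
      show "isCont (\<lambda>t. H x (step t)) t"
        if "t \<notin> range (\<lambda>i. lower (x $ i)) \<union> range (\<lambda>i. upper (x $ i))" for t
        using isCont_level_sets[OF that, of \<mu>\<^sub>r] by (simp add: step_eq)
      show "a \<le> b"
        using a bounds(2) order_trans by blast
    qed (fact H_add H_mono)+
    then show ?thesis
      by (simp add: Ch\<^sub>r_def step_eq top bottom integral_unique flip: a_def b_def)
  qed
  ultimately show ?thesis by blast
qed

end
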